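(* Let $X_4$ be the affine surface $x_4^2-2x_3^2+x_2^2=x_3^2-2x_2^2+x_1^2=2$ and let $\zeta=\varphi\tau\mu_{14}$ be the birational map on $X_4$ defined in the context. For any $t\in\mathbb{Z}$ and any non-negative integer $n$, the $n$-th iterate $$\zeta^{(n)}(t,t+1,t+2,t+3)$$ has the form $$\xi(n,t)=(\xi_1(n,t),\xi_2(n,t),\xi_3(n,t),\xi_4(n,t)),$$ where each $\xi_i(n,t)$ is a polynomial in $t$ of degree $2n+1$.
   Context: $X_4$ is the affine variety over $\mathbb{Q}$ in coordinates $(x_1,x_2,x_3,x_4)$ defined by $x_4^2-2x_3^2+x_2^2=2$ and $x_3^2-2x_2^2+x_1^2=2$. Rational maps on $X_4$ are, as usual, identified when they agree on a dense open subset of $X_4$; a rational map is defined at a point as soon as some representative (expression by rational functions agreeing with it on a dense open subset of $X_4$) is regular at that point. Products of maps denote composition, and $\zeta^{(n)}$ is the $n$-fold composition of $\zeta$ with itself ($\zeta^{(0)}$ is the identity). Let $\tau(a,b,c,d)=(d,c,b,a)$ and $\mu_{14}(a,b,c,d)=(-a,b,c,-d)$. Let $\varphi=\left(\frac{p_1}{q},\frac{p_2}{q},\frac{p_3}{q},\frac{p_4}{q}\right)$, where, in the variables $(a,b,c,d)$, $$q=(b-c)^2(a-2b+c),$$ $$p_1=-2ab^3+ab^2c+2ab^2d+4abc^2-5abcd+ab-2ac^3+2ac^2d+ac-ad+3b^4-2b^3c-3b^3d-6b^2c^2+8b^2cd+b^2+4bc^3-4bc^2d-5bc+bd+c^2+cd-2,$$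 $$p_2=-2ab^2c+5abc^2-2abcd+2ab-2ac^3+ac^2d-ad+3b^3c-8b^2c^2+3b^2cd-2b^2+4bc^3-2bc^2d-bc+2bd-2,$$ $$p_3=-2ab^3+5ab^2c-2ab^2d-2abc^2+abcd+3ab-ac-ad+3b^4-8b^3c+3b^3d+4b^2c^2-2b^2cd-3b^2-bc+3bd+c^2-cd-2,$$ $$p_4=-3ab^3+8ab^2c-3ab^2d-4abc^2+2abcd+4ab-2ac-ad+4b^4-10b^3c+4b^3d+2b^2c^2-2b^2cd-4b^2+5bc^3-2bc^2d-bc+4bd-2c^4+c^3d+2c^2-2cd-2.$$ Then $\varphi$ is a birational map on $X_4$, and $\zeta=\varphi\tau\mu_{14}$, i.e. $\zeta(a,b,c,d)=\varphi(-d,c,b,-a)$. *)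

theory Defs
  imports Complex_Main "HOL-Analysis.Abstract_Topology" "HOL-Computational_Algebra.Polynomial"
begin

text \<open>
  Affine varieties over the rationals are treated classically: points have coordinates in the
  algebraically closed field of complex numbers, polynomials have rational coefficients.
\<close>

type_synonym pt = "complex \<times> complex \<times> complex \<times> complex"

definition X4 :: "pt set" where
  "X4 = {(x1, x2, x3, x4). x4^2 - 2*x3^2 + x2^2 = 2 \<and> x3^2 - 2*x2^2 + x1^2 = 2}"

inductive_set qpoly :: "(pt \<Rightarrow> complex) set" where
  const: "(\<lambda>_. of_rat r) \<in> qpoly"
| var1: "(\<lambda>(a, b, c, d). a) \<in> qpoly"
| var2: "(\<lambda>(a, b, c, d). b) \<in> qpoly"
| var3: "(\<lambda>(a, b, c, d). c) \<in> qpoly"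
| var4: "(\<lambda>(a, b, c, d). d) \<in> qpoly"
| add: "f \<in> qpoly \<Longrightarrow> g \<in> qpoly \<Longrightarrow> (\<lambda>x. f x + g x) \<in> qpoly"
| mult: "f \<in> qpoly \<Longrightarrow> g \<in> qpoly \<Longrightarrow> (\<lambda>x. f x * g x) \<in> qpoly"

definition zariski :: "pt topology" where
  "zariski = topology_generated_by {{x \<in> X4. f x \<noteq> 0} | f. f \<in> qpoly}"

definition dense_open :: "pt set \<Rightarrow> bool" where
  "dense_open U \<longleftrightarrow> openin zariski U \<and> zariski closure_of U = topspace zariski"

text \<open>
  Rational maps on \<open>X4\<close> are given by partial functions. Agreement includes definedness: both
  sides have a value on the dense open set.
\<close>

definition same_rational_map :: "(pt \<rightharpoonup> pt) \<Rightarrow> (pt \<rightharpoonup> pt) \<Rightarrow> bool" where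
  "same_rational_map F G \<longleftrightarrow>
     (\<exists>U. dense_open U \<and> (\<forall>x\<in>U. F x \<noteq> None \<and> F x = G x))"

definition frac_map ::
  "(pt \<Rightarrow> complex) \<Rightarrow> (pt \<Rightarrow> complex) \<Rightarrow> (pt \<Rightarrow> complex) \<Rightarrow> (pt \<Rightarrow> complex) \<Rightarrow>
   (pt \<Rightarrow> complex) \<Rightarrow> (pt \<rightharpoonup> pt)" where
  "frac_map f1 f2 f3 f4 g x =
     (if x \<in> X4 \<and> g x \<noteq> 0 then Some (f1 x / g x, f2 x / g x, f3 x / g x, f4 x / g x) else None)"

text \<open>
  The rational map represented by \<open>F\<close> is defined at \<open>p\<close>, with value \<open>v\<close>. A common denominator
  loses no generality, since denominators that do not vanish at \<open>p\<close> can be multiplied together.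
\<close>

definition has_value_at :: "(pt \<rightharpoonup> pt) \<Rightarrow> pt \<Rightarrow> pt \<Rightarrow> bool" where
  "has_value_at F p v \<longleftrightarrow>
     (\<exists>f1 \<in> qpoly. \<exists>f2 \<in> qpoly. \<exists>f3 \<in> qpoly. \<exists>f4 \<in> qpoly. \<exists>g \<in> qpoly.
        same_rational_map F (frac_map f1 f2 f3 f4 g) \<and> frac_map f1 f2 f3 f4 g p = Some v)"

fun phi_q :: "pt \<Rightarrow> complex" where
  "phi_q (a, b, c, d) =
      (b - c)^2 * (a - 2*b + c)"

fun phi_p1 :: "pt \<Rightarrow> complex" where
  "phi_p1 (a, b, c, d) =
      -2*a*b^3 + a*b^2*c + 2*a*b^2*d + 4*a*b*c^2 - 5*a*b*c*d + a*b - 2*a*c^3 + 2*a*c^2*d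
      + a*c - a*d + 3*b^4 - 2*b^3*c - 3*b^3*d - 6*b^2*c^2 + 8*b^2*c*d + b^2 + 4*b*c^3
      - 4*b*c^2*d - 5*b*c + b*d + c^2 + c*d - 2"

fun phi_p2 :: "pt \<Rightarrow> complex" where
  "phi_p2 (a, b, c, d) =
      -2*a*b^2*c + 5*a*b*c^2 - 2*a*b*c*d + 2*a*b - 2*a*c^3 + a*c^2*d - a*d + 3*b^3*c
      - 8*b^2*c^2 + 3*b^2*c*d - 2*b^2 + 4*b*c^3 - 2*b*c^2*d - b*c + 2*b*d - 2"

fun phi_p3 :: "pt \<Rightarrow> complex" where
  "phi_p3 (a, b, c, d) =
      -2*a*b^3 + 5*a*b^2*c - 2*a*b^2*d - 2*a*b*c^2 + a*b*c*d + 3*a*b - a*c - a*d + 3*b^4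
      - 8*b^3*c + 3*b^3*d + 4*b^2*c^2 - 2*b^2*c*d - 3*b^2 - b*c + 3*b*d + c^2 - c*d - 2"

fun phi_p4 :: "pt \<Rightarrow> complex" where
  "phi_p4 (a, b, c, d) =
      -3*a*b^3 + 8*a*b^2*c - 3*a*b^2*d - 4*a*b*c^2 + 2*a*b*c*d + 4*a*b - 2*a*c - a*d + 4*b^4
      - 10*b^3*c + 4*b^3*d + 2*b^2*c^2 - 2*b^2*c*d - 4*b^2 + 5*b*c^3 - 2*b*c^2*d - b*c
      + 4*b*d - 2*c^4 + c^3*d + 2*c^2 - 2*c*d - 2"

definition phi :: "pt \<rightharpoonup> pt" where
  "phi = frac_map phi_p1 phi_p2 phi_p3 phi_p4 phi_q"

fun tau :: "pt \<Rightarrow> pt" where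
  "tau (a, b, c, d) = (d, c, b, a)"

fun mu14 :: "pt \<Rightarrow> pt" where
  "mu14 (a, b, c, d) = (- a, b, c, - d)"

definition zeta :: "pt \<rightharpoonup> pt" where
  "zeta = phi \<circ> tau \<circ> mu14"

primrec zeta_iter :: "nat \<Rightarrow> (pt \<rightharpoonup> pt)" where
  "zeta_iter 0 = Some |` X4"
| "zeta_iter (Suc n) = zeta \<circ>\<^sub>m zeta_iter n"

text \<open>Sanity checks: the topology lives on \<open>X4\<close>, and the value at a point is unique.\<close>

lemma openin_nonzero: "f \<in> qpoly \<Longrightarrow> openin zariski {x \<in> X4. f x \<noteq> 0}"
  unfolding zariski_def by (rule topology_generated_by_Basis) blast

lemma topspace_zariski: "topspace zariski = X4"
proof -
  have "openin zariski X4" using openin_nonzero[OF qpoly.const[of 1]] by simp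
  then have "X4 \<subseteq> topspace zariski" by (rule openin_subset)
  moreover have "topspace zariski \<subseteq> X4"
    unfolding zariski_def topology_generated_by_topspace by blast
  ultimately show ?thesis by blast
qed

lemma qpoly_cross:
  assumes "f \<in> qpoly" "g \<in> qpoly" "f' \<in> qpoly" "g' \<in> qpoly"
  shows "(\<lambda>x. f x * g' x - f' x * g x) \<in> qpoly"
proof -
  have "(\<lambda>x. f x * g' x + of_rat (- 1) * (f' x * g x)) \<in> qpoly"
    using assms by (intro qpoly.add qpoly.mult qpoly.const)
  then show ?thesis by (simp add: of_rat_minus)
qed

lemma dense_meets:
  assumes "dense_open U" "openin zariski V" "V \<noteq> {}"
  shows "\<exists>x. x \<in> U \<and> x \<in> V"
  using assms unfolding dense_open_def
  by (metis Int_emptyI dense_intersects_open disjoint_iff)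

lemma has_value_at_unique:
  assumes "has_value_at F p v" "has_value_at F p w"
  shows "v = w"
proof -
  obtain f1 f2 f3 f4 g U where f: "f1 \<in> qpoly" "f2 \<in> qpoly" "f3 \<in> qpoly" "f4 \<in> qpoly" "g \<in> qpoly"
    and U: "dense_open U" "\<And>x. x \<in> U \<Longrightarrow> F x \<noteq> None \<and> F x = frac_map f1 f2 f3 f4 g x"
    and v: "frac_map f1 f2 f3 f4 g p = Some v"
    using assms(1) unfolding has_value_at_def same_rational_map_def by blast
  obtain h1 h2 h3 h4 k V where h: "h1 \<in> qpoly" "h2 \<in> qpoly" "h3 \<in> qpoly" "h4 \<in> qpoly" "k \<in> qpoly"
    and V: "dense_open V" "\<And>x. x \<in> V \<Longrightarrow> F x \<noteq> None \<and> F x = frac_map h1 h2 h3 h4 k x"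
    and w: "frac_map h1 h2 h3 h4 k p = Some w"
    using assms(2) unfolding has_value_at_def same_rational_map_def by blast
  from v w have p: "p \<in> X4" "g p \<noteq> 0" "k p \<noteq> 0"
    by (auto simp: frac_map_def split: if_splits)
  have agree: "e p / g p = e' p / k p"
    if e: "e \<in> qpoly" "e' \<in> qpoly"
      and eq: "\<And>x. x \<in> U \<Longrightarrow> x \<in> V \<Longrightarrow> e x * k x = e' x * g x" for e e'
  proof (rule ccontr)
    define W where "W = {x \<in> X4. e x * k x - e' x * g x \<noteq> 0}"
    assume "e p / g p \<noteq> e' p / k p"
    then have "p \<in> W" using p by (simp add: W_def field_simps)
    moreover have oW: "openin zariski W"
      unfolding W_def using openin_nonzero[OF qpoly_cross[OF e(1) f(5) e(2) h(5)]] by simp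
    ultimately obtain y where y: "y \<in> U" "y \<in> W" using dense_meets[OF U(1) oW] by blast
    have "openin zariski (U \<inter> W)" using U(1) oW by (auto simp: dense_open_def)
    then obtain z where "z \<in> V" "z \<in> U \<inter> W" using dense_meets[OF V(1), of "U \<inter> W"] y by blast
    then show False using eq[of z] by (auto simp: W_def)
  qed
  have *: "f1 x * k x = h1 x * g x" "f2 x * k x = h2 x * g x"
    "f3 x * k x = h3 x * g x" "f4 x * k x = h4 x * g x" if "x \<in> U" "x \<in> V" for x
    using U(2)[OF that(1)] V(2)[OF that(2)]
    by (auto simp: frac_map_def frac_eq_eq split: if_splits)
  have "f1 p / g p = h1 p / k p" "f2 p / g p = h2 p / k p"
    "f3 p / g p = h3 p / k p" "f4 p / g p = h4 p / k p"
    using f h * by (auto intro!: agree)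
  then show ?thesis using v w p by (simp add: frac_map_def)
qed

end

theory Submission
  imports Defs
begin

text \<open>
  The equations of \<open>X4\<close> give \<open>(d - a)(d + a) = 3(c - b)(c + b)\<close>, so \<open>m = (a + d)/(c - b)\<close> is a
  conic fibration. On its fibres, with \<open>u = c - b\<close> and \<open>w = (d - a)/3\<close>, the surface is the Pell
  conic \<open>(m^2 - 1)u^2 - (m^2 - 9)w^2 = 8\<close>. The map \<open>zeta\<close> preserves every fibre and acts on it as
  multiplication by the unit \<open>(m^2 - 5 + sqrt ((m^2 - 1)(m^2 - 9)))/4\<close>, a linear map of \<open>(u, w)\<close>
  whose entries are quadratic in \<open>m\<close>. The line \<open>(t, t+1, t+2, t+3)\<close> is the section
  \<open>u = w = 1\<close>, \<open>m = 2t + 3\<close>, so each iteration raises the degree in \<open>t\<close> by two.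

  The formula for the iterates is regular wherever \<open>c \<noteq> b\<close>, but it agrees with the composite of the
  partial maps only outside the indeterminacy of each step. That the complement is dense follows from
  one fibre of the projection to \<open>(b, c)\<close> contained in it: along the line from a given point of the
  \<open>(b, c)\<close>-plane to that fibre, the norm of a function is a polynomial with finitely many zeros,
  and square root branches lift a punctured neighbourhood to nearby points of the surface.
\<close>

section \<open>Conic fibration and the action of \<open>zeta\<close> on a fibre\<close>

text \<open>Solves \<open>a + d = m*u\<close>, \<open>b + c = m*w\<close>, \<open>c - b = u\<close>,
  \<open>d - a = 3*w\<close> for the coordinates.\<close>

definition conic_point :: "complex \<Rightarrow> complex \<Rightarrow> complex \<Rightarrow> pt" where
  "conic_point m u w = ((m*u - 3*w)/2, (m*w - u)/2, (u + m*w)/2, (m*u + 3*w)/2)"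

lemma conic_point_in_X4:
  assumes "(m^2 - 1)*u^2 - (m^2 - 9)*w^2 = 8"
  shows "conic_point m u w \<in> X4"
proof -
  have "((m*u + 3*w)/2)^2 - 2*((u + m*w)/2)^2 + ((m*w - u)/2)^2 = ((m^2 - 1)*u^2 - (m^2 - 9)*w^2)/4"
    "((u + m*w)/2)^2 - 2*((m*w - u)/2)^2 + ((m*u - 3*w)/2)^2 = ((m^2 - 1)*u^2 - (m^2 - 9)*w^2)/4"
    by (simp_all add: field_simps power2_eq_square)
  then show ?thesis using assms by (simp add: X4_def conic_point_def)
qed

lemma conic_point_of_X4:
  assumes "(a, b, c, d) \<in> X4" "c \<noteq> b"
  defines "m \<equiv> (a + d)/(c - b)" and "u \<equiv> c - b" and "w \<equiv> (d - a)/3"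
  shows "(a, b, c, d) = conic_point m u w" "(m^2 - 1)*u^2 - (m^2 - 9)*w^2 = 8"
proof -
  have eqs: "d^2 - 2*c^2 + b^2 = 2" "c^2 - 2*b^2 + a^2 = 2"
    using assms(1) by (simp_all add: X4_def)
  have u: "u \<noteq> 0" using assms(2) by (simp add: u_def)
  have mu: "m*u = a + d" using assms(2) by (simp add: m_def u_def)
  have w: "3*w = d - a" by (simp add: w_def)
  \<comment> \<open>This is one third of the difference of the two surface equations.\<close>
  have "u*(m*w) = u*(c + b)" using mu w eqs u_def by algebra
  then have mw: "m*w = c + b" using u by simp
  show "(a, b, c, d) = conic_point m u w"
    unfolding conic_point_def mu mw using w by (simp add: u_def)
  show "(m^2 - 1)*u^2 - (m^2 - 9)*w^2 = 8"
    using mu mw w eqs u_def by algebra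
qed

text \<open>
  With \<open>a + d = m*u\<close>, \<open>b + c = m*w\<close>, \<open>c - b = u\<close> and \<open>d - a = 3*w\<close> the long factors are
  \<open>24*u^2\<close> times the coordinates of the image point. The cofactors of \<open>r\<close> and \<open>s\<close> are the quotients
  of a division by the two equations of the surface, as polynomials in \<open>a\<close> and \<open>d\<close>.
\<close>

lemma phi_numerators_mod_X4:
  fixes a b c d :: complex
  defines "r \<equiv> a^2 - 2*b^2 + c^2 - 2" and "s \<equiv> d^2 - 2*c^2 + b^2 - 2"
  shows
    "24 * phi_p1 (- d, c, b, - a) = (b - 2*c - d) * (3*((a + d)*((a + d)^2 - 5*(c - b)^2) + (b + c)*((a + d)^2 - 9*(c - b)^2)) - 3*(3*(c - b)*((a + d)^2 - (c - b)^2) + (d - a)*((a + d)^2 - 5*(c - b)^2)))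
       + (-6*a*b + 12*a*c + 6*a*d - 12*b^2 + 30*b*c - 12*c^2 + 18*c*d + 12*d^2) * r
       + (18*a*b + 6*a*d + 12*b^2 + 30*b*c + 12*b*d - 24*c^2 - 6*c*d + 24) * s"
    "24 * phi_p2 (- d, c, b, - a) = (b - 2*c - d) * (3*((a + d)*((a + d)^2 - (c - b)^2) + (b + c)*((a + d)^2 - 5*(c - b)^2)) - (3*(c - b)*((a + d)^2 - 5*(c - b)^2) + (d - a)*((a + d)^2 - 9*(c - b)^2)))
       + (-4*a*b + 8*a*c + 4*a*d - 6*b^2 + 12*b*c - 4*b*d + 20*c*d + 10*d^2) * r
       + (4*a*b + 16*a*c + 8*a*d + 18*b^2 + 4*b*d + 4*c*d + 2*d^2 + 24) * s"
    "24 * phi_p3 (- d, c, b, - a) = (b - 2*c - d) * ((3*(c - b)*((a + d)^2 - 5*(c - b)^2) + (d - a)*((a + d)^2 - 9*(c - b)^2)) + 3*((a + d)*((a + d)^2 - (c - b)^2) + (b + c)*((a + d)^2 - 5*(c - b)^2)))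
       + (-2*a*b + 4*a*c + 2*a*d - 6*b*c - 8*b*d + 12*c^2 + 22*c*d + 8*d^2) * r
       + (-10*a*b + 32*a*c + 10*a*d + 18*b*c - 4*b*d + 14*c*d + 4*d^2 + 24) * s"
    "24 * phi_p4 (- d, c, b, - a) = (b - 2*c - d) * (3*((a + d)*((a + d)^2 - 5*(c - b)^2) + (b + c)*((a + d)^2 - 9*(c - b)^2)) + 3*(3*(c - b)*((a + d)^2 - (c - b)^2) + (d - a)*((a + d)^2 - 5*(c - b)^2)))
       + (6*b^2 - 24*b*c - 12*b*d + 24*c^2 + 24*c*d + 6*d^2) * r
       + (-24*a*b + 48*a*c + 12*a*d - 18*b^2 + 36*b*c - 12*b*d + 24*c*d + 6*d^2 + 24) * s"
  unfolding r_def s_def phi_p1.simps phi_p2.simps phi_p3.simps phi_p4.simps by algebra+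

text \<open>At \<open>(- d, c, b, - a)\<close> the denominator \<open>phi_q\<close> equals
  \<open>- u^2*(m + 3)*(u + w)/2\<close>; the conditions \<open>nz\<close> say that it is
  nonzero.\<close>

lemma zeta_conic_point:
  assumes conic: "(m^2 - 1)*u^2 - (m^2 - 9)*w^2 = 8"
    and nz: "u \<noteq> 0" "m + 3 \<noteq> 0" "u + w \<noteq> 0"
  shows "zeta (conic_point m u w) =
    Some (conic_point m (((m^2 - 5)*u + (m^2 - 9)*w)/4) (((m^2 - 1)*u + (m^2 - 5)*w)/4))"
proof -
  define a b c d where "a = (m*u - 3*w)/2" and "b = (m*w - u)/2" and "c = (u + m*w)/2"
    and "d = (m*u + 3*w)/2"
  note pdefs = a_def b_def c_def d_def
  define x where "x = (- d, c, b, - a)"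
  have X: "(a, b, c, d) \<in> X4"
    using conic_point_in_X4[OF conic] unfolding pdefs by (simp add: conic_point_def pdefs)
  then have "x \<in> X4" by (auto simp: X4_def x_def algebra_simps)
  have rs: "a^2 - 2*b^2 + c^2 - 2 = 0" "d^2 - 2*c^2 + b^2 - 2 = 0"
    using X by (simp_all add: X4_def algebra_simps)
  have sums: "a + d = m*u" "b + c = m*w" "c - b = u" "d - a = 3*w"
    by (simp_all add: pdefs field_simps)
  define L where "L = b - 2*c - d"
  have L: "L = - ((m + 3)*(u + w)/2)"
    unfolding L_def pdefs by (simp add: field_simps)
  have "phi_q x = (c - b)^2 * L"
    by (simp add: x_def L_def algebra_simps)
  then have q: "phi_q x = u^2 * L" by (simp only: sums)
  then have q0: "phi_q x \<noteq> 0" using nz L by simp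
  define u' w' where "u' = ((m^2 - 5)*u + (m^2 - 9)*w)/4" and "w' = ((m^2 - 1)*u + (m^2 - 5)*w)/4"
  \<comment> \<open>The variables first occur in the order \<open>d c b a\<close>, so each keeps its
    name; \<open>rs\<close> removes the cofactor terms.\<close>
  note num = phi_numerators_mod_X4[of d c b a, unfolded rs, folded x_def L_def, unfolded sums]
  have k: "m*u*((m*u)^2 - 5*u^2) + m*w*((m*u)^2 - 9*u^2) = 4*u^2*(m*u')"
    "3*u*((m*u)^2 - u^2) + 3*w*((m*u)^2 - 5*u^2) = 12*u^2*w'"
    "m*u*((m*u)^2 - u^2) + m*w*((m*u)^2 - 5*u^2) = 4*u^2*(m*w')"
    "3*u*((m*u)^2 - 5*u^2) + 3*w*((m*u)^2 - 9*u^2) = 12*u^2*u'"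
    unfolding u'_def w'_def by (simp_all add: field_simps power2_eq_square)
  have "phi_p1 x = phi_q x * ((m*u' - 3*w')/2)"
    using num(1) unfolding k q by algebra
  moreover have "phi_p2 x = phi_q x * ((m*w' - u')/2)"
    using num(2) unfolding k q by algebra
  moreover have "phi_p3 x = phi_q x * ((u' + m*w')/2)"
    using num(3) unfolding k q by algebra
  moreover have "phi_p4 x = phi_q x * ((m*u' + 3*w')/2)"
    using num(4) unfolding k q by algebra
  moreover have "zeta (a, b, c, d) = phi x"
    by (simp add: zeta_def x_def)
  ultimately show ?thesis
    using q0 \<open>x \<in> X4\<close> unfolding phi_def frac_map_def
    by (simp add: conic_point_def pdefs u'_def w'_def)
qed

section \<open>Zariski density on the surface\<close>

lemma qpoly_numeral: "(\<lambda>_. numeral n) \<in> qpoly"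
  using qpoly.const[of "numeral n"] by simp

lemma qpoly_one: "(\<lambda>_. 1) \<in> qpoly"
  using qpoly.const[of 1] by simp

lemma qpoly_diff:
  assumes "f \<in> qpoly" "g \<in> qpoly"
  shows "(\<lambda>x. f x - g x) \<in> qpoly"
  using qpoly_cross[OF assms(1) qpoly_one assms(2) qpoly_one] by simp

lemma qpoly_power: "f \<in> qpoly \<Longrightarrow> (\<lambda>x. f x ^ n) \<in> qpoly"
  by (induction n) (auto intro: qpoly_one qpoly.mult)

lemma qpoly_prod: "(\<And>i. i \<in> I \<Longrightarrow> f i \<in> qpoly) \<Longrightarrow> (\<lambda>x. \<Prod>i\<in>I. f i x) \<in> qpoly"
  by (induction I rule: infinite_finite_induct) (auto intro: qpoly_one qpoly.mult)

lemmas qpoly_intros = qpoly_numeral qpoly_one qpoly_diff qpoly_power qpoly.add qpoly.mult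

lemma qpoly_continuous: "f \<in> qpoly \<Longrightarrow> continuous_on UNIV f"
  by (induction rule: qpoly.induct) (auto simp: case_prod_unfold intro!: continuous_intros)

text \<open>Polynomials are continuous, so Zariski neighbourhoods can be entered by limits in the
  usual topology.\<close>

lemma openin_zariski_imp_euclidean:
  assumes "openin zariski V"
  shows "\<exists>T. open T \<and> V = X4 \<inter> T"
proof -
  have "generate_topology_on {{x \<in> X4. f x \<noteq> 0} | f. f \<in> qpoly} V"
    using assms by (simp add: zariski_def openin_topology_generated_by_iff)
  then show ?thesis
  proof (induction rule: generate_topology_on.induct)
    case Empty
    show ?case by (intro exI[of _ "{}"]) simp
  next
    case (Int a b)
    then obtain S T where "open S" "a = X4 \<inter> S" "open T" "b = X4 \<inter> T" by blast
    then show ?case by (intro exI[of _ "S \<inter> T"]) auto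
  next
    case (UN K)
    then have "\<forall>k\<in>K. \<exists>T. open T \<and> k = X4 \<inter> T" by blast
    then obtain T where T: "\<And>k. k \<in> K \<Longrightarrow> open (T k) \<and> k = X4 \<inter> T k" by metis
    then have "\<Union>K = X4 \<inter> (\<Union>k\<in>K. T k)" by blast
    then show ?case using T by (intro exI[of _ "\<Union>k\<in>K. T k"]) auto
  next
    case (Basis s)
    then obtain f where f: "f \<in> qpoly" "s = {x \<in> X4. f x \<noteq> 0}" by blast
    have "open {x. f x \<noteq> 0}"
      using qpoly_continuous[OF f(1)] by (intro open_Collect_neq) auto
    then show ?case using f(2) by (intro exI[of _ "{x. f x \<noteq> 0}"]) auto
  qed
qed

text \<open>Of the two roots of \<open>q s\<close> take the one nearer to \<open>x\<close>: since
  \<open>q s - x^2 = (y - x)*(y + x)\<close>, its distance to \<open>x\<close> is at most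
  \<open>sqrt (norm (q s - x^2))\<close>. This covers the branch point \<open>x = 0\<close>
  too.\<close>

lemma sqrt_branch:
  fixes q :: "complex \<Rightarrow> complex"
  assumes "(q \<longlongrightarrow> x^2) F"
  shows "\<exists>r. (\<forall>s. r s ^ 2 = q s) \<and> (r \<longlongrightarrow> x) F"
proof -
  have "\<exists>y. y^2 = q s \<and> norm (y - x) \<le> sqrt (norm (q s - x^2))" for s
  proof -
    define y where "y = csqrt (q s)"
    have y: "y^2 = q s" by (simp add: y_def)
    have "q s - x^2 = (y - x)*(y + x)" unfolding y[symmetric] by algebra
    then have eq: "norm (q s - x^2) = norm (y - x) * norm (y + x)"
      by (simp add: norm_mult)
    show ?thesis
    proof (cases "norm (y - x) \<le> norm (y + x)")
      case True
      then have "norm (y - x)^2 \<le> norm (q s - x^2)"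
        unfolding eq unfolding power2_eq_square by (intro mult_left_mono) auto
      then show ?thesis using y real_le_rsqrt by blast
    next
      case False
      then have "norm (y + x)^2 \<le> norm (q s - x^2)"
        unfolding eq unfolding power2_eq_square by (intro mult_right_mono) auto
      moreover have "norm (- y - x) = norm (y + x)"
        by (metis minus_add_distrib norm_minus_cancel uminus_add_conv_diff diff_conv_add_uminus)
      ultimately have "norm (- y - x) \<le> sqrt (norm (q s - x^2))"
        using real_le_rsqrt by simp
      then show ?thesis using y by (intro exI[of _ "- y"]) simp
    qed
  qed
  then obtain r where r: "\<And>s. r s ^ 2 = q s" "\<And>s. norm (r s - x) \<le> sqrt (norm (q s - x^2))"
    by metis
  have "((\<lambda>s. norm (q s - x^2)) \<longlongrightarrow> 0) F"
    using assms by (simp add: tendsto_norm_zero_iff LIM_zero_iff)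
  then have "((\<lambda>s. sqrt (norm (q s - x^2))) \<longlongrightarrow> 0) F"
    using tendsto_real_sqrt[of _ 0] by simp
  then have "(r \<longlongrightarrow> x) F"
    by (rule metric_tendsto_imp_tendsto) (simp add: dist_norm r(2))
  then show ?thesis using r(1) by blast
qed

text \<open>As \<open>x^2\<close> and \<open>y^2\<close> are polynomials in \<open>s\<close>, the
  span of \<open>1\<close>, \<open>x\<close>, \<open>y\<close>, \<open>x*y\<close> over the
  polynomials in \<open>s\<close> is closed under products.\<close>

lemma qpoly_normal_form:
  fixes P Q R S :: "complex poly"
  assumes "f \<in> qpoly"
  shows "\<exists>A B C D. \<forall>s x y. x^2 = poly R s \<longrightarrow> y^2 = poly S s \<longrightarrow>
    f (x, poly P s, poly Q s, y) = poly A s + poly B s * x + poly C s * y + poly D s * (x*y)"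
  using assms
proof (induction rule: qpoly.induct)
  case (const r)
  show ?case by (intro exI[of _ "[:of_rat r:]"] exI[of _ 0]) simp
next
  case var1
  show ?case by (rule exI[of _ 0], rule exI[of _ 1], rule exI[of _ 0], rule exI[of _ 0]) simp
next
  case var2
  show ?case by (rule exI[of _ P], rule exI[of _ 0], rule exI[of _ 0], rule exI[of _ 0]) simp
next
  case var3
  show ?case by (rule exI[of _ Q], rule exI[of _ 0], rule exI[of _ 0], rule exI[of _ 0]) simp
next
  case var4
  show ?case by (rule exI[of _ 0], rule exI[of _ 0], rule exI[of _ 1], rule exI[of _ 0]) simp
next
  case (add f g)
  then obtain A B C D A' B' C' D' where
    "\<forall>s x y. x^2 = poly R s \<longrightarrow> y^2 = poly S s \<longrightarrow>
      f (x, poly P s, poly Q s, y) = poly A s + poly B s * x + poly C s * y + poly D s * (x*y)"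
    "\<forall>s x y. x^2 = poly R s \<longrightarrow> y^2 = poly S s \<longrightarrow>
      g (x, poly P s, poly Q s, y) = poly A' s + poly B' s * x + poly C' s * y + poly D' s * (x*y)"
    by blast
  then show ?case
    by (intro exI[of _ "A + A'"] exI[of _ "B + B'"] exI[of _ "C + C'"] exI[of _ "D + D'"])
       (simp add: algebra_simps)
next
  case (mult f g)
  then obtain A B C D A' B' C' D' where
    f: "\<forall>s x y. x^2 = poly R s \<longrightarrow> y^2 = poly S s \<longrightarrow>
      f (x, poly P s, poly Q s, y) = poly A s + poly B s * x + poly C s * y + poly D s * (x*y)" and
    g: "\<forall>s x y. x^2 = poly R s \<longrightarrow> y^2 = poly S s \<longrightarrow>
      g (x, poly P s, poly Q s, y) = poly A' s + poly B' s * x + poly C' s * y + poly D' s * (x*y)"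
    by blast
  have key: "(a + b*x + c*y + d*(x*y)) * (a' + b'*x + c'*y + d'*(x*y)) =
      (a*a' + b*b'*r + c*c'*t + d*d'*(r*t)) + (a*b' + b*a' + (c*d' + d*c')*t) * x
      + (a*c' + c*a' + (b*d' + d*b')*r) * y + (a*d' + d*a' + b*c' + c*b') * (x*y)"
    if "x^2 = r" "y^2 = t" for a b c d a' b' c' d' x y r t :: complex
    unfolding that[symmetric] by algebra
  show ?case
    by (rule exI[of _ "A*A' + B*B'*R + C*C'*S + D*D'*(R*S)"],
        rule exI[of _ "A*B' + B*A' + (C*D' + D*C')*S"],
        rule exI[of _ "A*C' + C*A' + (B*D' + D*B')*R"],
        rule exI[of _ "A*D' + D*A' + B*C' + C*B'"])
       (use f g key in simp)
qed

text \<open>The product over all sign changes of \<open>x\<close> and \<open>y\<close> is a norm,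
  hence free of both square roots.\<close>

lemma qpoly_norm:
  fixes P Q R S :: "complex poly"
  assumes "f \<in> qpoly"
  obtains N where "\<And>s x y. x^2 = poly R s \<Longrightarrow> y^2 = poly S s \<Longrightarrow>
    poly N s = f (x, poly P s, poly Q s, y) * f (- x, poly P s, poly Q s, y) *
      f (x, poly P s, poly Q s, - y) * f (- x, poly P s, poly Q s, - y)"
proof -
  obtain A B C D where f: "\<And>s x y. x^2 = poly R s \<Longrightarrow> y^2 = poly S s \<Longrightarrow>
    f (x, poly P s, poly Q s, y) = poly A s + poly B s * x + poly C s * y + poly D s * (x*y)"
    using qpoly_normal_form[OF assms] by blast
  \<comment> \<open>The two factors differing in the sign of \<open>x\<close> multiply to
    \<open>E + F*y\<close>; the other two give \<open>E - F*y\<close>.\<close>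
  define E where "E = A^2 + C^2*S - R*(B^2 + D^2*S)"
  define F where "F = 2*A*C - 2*R*B*D"
  have key: "(a + b*x + c*y + d*(x*y)) * (a - b*x + c*y - d*(x*y)) *
      (a + b*x - c*y - d*(x*y)) * (a - b*x - c*y + d*(x*y)) =
      (a^2 + c^2*t - r*(b^2 + d^2*t))^2 - t*(2*a*c - 2*r*b*d)^2"
    if "x^2 = r" "y^2 = t" for a b c d x y r t :: complex
    unfolding that[symmetric] by algebra
  show ?thesis
  proof (rule that[of "E^2 - S*F^2"])
    fix s x y assume xy: "x^2 = poly R s" "y^2 = poly S s"
    then show "poly (E^2 - S*F^2) s = f (x, poly P s, poly Q s, y) * f (- x, poly P s, poly Q s, y) *
      f (x, poly P s, poly Q s, - y) * f (- x, poly P s, poly Q s, - y)"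
      using key[OF xy, of "poly A s" "poly B s" "poly C s" "poly D s"]
      by (simp add: f E_def F_def)
  qed
qed

lemma dense_open_nonzero:
  assumes h: "h \<in> qpoly"
    and fib: "\<And>a d. (a, b, c, d) \<in> X4 \<Longrightarrow> h (a, b, c, d) \<noteq> 0"
  shows "dense_open {x \<in> X4. h x \<noteq> 0}"
  unfolding dense_open_def
proof
  show "openin zariski {x \<in> X4. h x \<noteq> 0}" by (rule openin_nonzero[OF h])
  have "p \<in> zariski closure_of {x \<in> X4. h x \<noteq> 0}" if p: "p \<in> X4" for p
    unfolding in_closure_of topspace_zariski
  proof (intro conjI allI impI)
    show "p \<in> X4" by (rule p)
    fix V assume V: "p \<in> V \<and> openin zariski V"
    then obtain T where T: "open T" "V = X4 \<inter> T"
      using openin_zariski_imp_euclidean by blast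
    obtain p1 p2 p3 p4 where p_eq: "p = (p1, p2, p3, p4)" by (cases p)
    \<comment> \<open>The line runs from \<open>(p2, p3)\<close> at \<open>s = 0\<close> to
      \<open>(b, c)\<close> at \<open>s = 1\<close>; on it the surface equations read
      \<open>a^2 = R\<close> and \<open>d^2 = S\<close>.\<close>
    define P Q where "P = [:p2, b - p2:]" and "Q = [:p3, c - p3:]"
    define R S where "R = 2*P^2 - Q^2 + 2" and "S = 2*Q^2 - P^2 + 2"
    obtain N where N: "\<And>s x y. x^2 = poly R s \<Longrightarrow> y^2 = poly S s \<Longrightarrow>
      poly N s = h (x, poly P s, poly Q s, y) * h (- x, poly P s, poly Q s, y) *
        h (x, poly P s, poly Q s, - y) * h (- x, poly P s, poly Q s, - y)"
      using qpoly_norm[OF h] by blast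
    have on_X4: "(x, poly P s, poly Q s, y) \<in> X4" if "x^2 = poly R s" "y^2 = poly S s" for s x y
      using that by (simp add: X4_def R_def S_def algebra_simps)
    \<comment> \<open>At \<open>s = 1\<close> all four sign choices lie on the fibre over
      \<open>(b, c)\<close>, where \<open>fib\<close> applies.\<close>
    have "poly N 1 \<noteq> 0"
    proof -
      define x y where "x = csqrt (poly R 1)" and "y = csqrt (poly S 1)"
      have xy: "x^2 = poly R 1" "y^2 = poly S 1" by (simp_all add: x_def y_def)
      have "h (x', b, c, y') \<noteq> 0" if "x' \<in> {x, - x}" "y' \<in> {y, - y}" for x' y'
        using that xy on_X4[of x' 1 y'] by (intro fib) (auto simp: P_def Q_def)
      then show ?thesis using N[OF xy] by (simp add: P_def Q_def)
    qed
    then have "N \<noteq> 0" by auto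
    then have "finite {s. poly N s = 0}" by (rule poly_roots_finite)
    \<comment> \<open>If \<open>h p = 0\<close> then \<open>N\<close> vanishes at 0, so the
      neighbourhood must be punctured.\<close>
    then have ev_N: "eventually (\<lambda>s. poly N s \<noteq> 0) (at 0)"
      unfolding eventually_at_topological
      by (intro exI[of _ "- ({s. poly N s = 0} - {0})"] conjI open_Compl finite_imp_closed) auto
    have at0: "poly R 0 = p1^2" "poly S 0 = p4^2"
      using p by (simp_all add: p_eq X4_def R_def S_def P_def Q_def algebra_simps)
    have lim: "((\<lambda>s. poly F s) \<longlongrightarrow> poly F 0) (at 0)" for F :: "complex poly"
      by (intro tendsto_poly tendsto_ident_at)
    obtain r1 where r1: "\<And>s. r1 s ^ 2 = poly R s" "(r1 \<longlongrightarrow> p1) (at 0)"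
      using sqrt_branch[OF lim[of R, unfolded at0]] by blast
    obtain r4 where r4: "\<And>s. r4 s ^ 2 = poly S s" "(r4 \<longlongrightarrow> p4) (at 0)"
      using sqrt_branch[OF lim[of S, unfolded at0]] by blast
    have "((\<lambda>s. (r1 s, poly P s, poly Q s, r4 s)) \<longlongrightarrow> (p1, poly P 0, poly Q 0, p4)) (at 0)"
      by (intro tendsto_Pair r1 r4 lim)
    then have "((\<lambda>s. (r1 s, poly P s, poly Q s, r4 s)) \<longlongrightarrow> p) (at 0)"
      by (simp add: p_eq P_def Q_def)
    then have "eventually (\<lambda>s. (r1 s, poly P s, poly Q s, r4 s) \<in> T) (at 0)"
      using T V by (auto intro: topological_tendstoD)
    with ev_N have "eventually (\<lambda>s. poly N s \<noteq> 0 \<and> (r1 s, poly P s, poly Q s, r4 s) \<in> T) (at 0)"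
      by (rule eventually_conj)
    from eventually_happens'[OF at_neq_bot this]
    obtain s where s: "poly N s \<noteq> 0" "(r1 s, poly P s, poly Q s, r4 s) \<in> T"
      by blast
    then have "h (r1 s, poly P s, poly Q s, r4 s) \<noteq> 0"
      using N[OF r1(1) r4(1)] by auto
    then show "\<exists>y. y \<in> {x \<in> X4. h x \<noteq> 0} \<and> y \<in> V"
      using s(2) on_X4[OF r1(1) r4(1)] T(2) by blast
  qed
  then show "zariski closure_of {x \<in> X4. h x \<noteq> 0} = topspace zariski"
    using closure_of_subset_topspace[of zariski "{x \<in> X4. h x \<noteq> 0}"]
    unfolding topspace_zariski by blast
qed

section \<open>Iteration on the fibres\<close>

text \<open>
  The action of \<open>zeta\<close> on \<open>(u, w)\<close> for \<open>m = e/k\<close>, scaled by \<open>4*k^2\<close> at each step so that it makes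
  sense over any commutative ring; it is used over the complex numbers, the reals and \<open>rat poly\<close>.
\<close>

fun pell_u :: "'a::comm_ring_1 \<Rightarrow> 'a \<Rightarrow> 'a \<Rightarrow> 'a \<Rightarrow> nat \<Rightarrow> 'a"
  and pell_w :: "'a \<Rightarrow> 'a \<Rightarrow> 'a \<Rightarrow> 'a \<Rightarrow> nat \<Rightarrow> 'a" where
  "pell_u e k u w 0 = u"
| "pell_w e k u w 0 = w"
| "pell_u e k u w (Suc n) = (e^2 - 5*k^2) * pell_u e k u w n + (e^2 - 9*k^2) * pell_w e k u w n"
| "pell_w e k u w (Suc n) = (e^2 - k^2) * pell_u e k u w n + (e^2 - 5*k^2) * pell_w e k u w n"

text \<open>Only ring operations and integer constants enter the recursion. This serves for
  \<open>of_real\<close> and for evaluation of a \<open>rat poly\<close>.\<close>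

lemma pell_hom:
  assumes "\<And>x y. h (x + y) = h x + h y" "\<And>x y. h (x * y) = h x * h y" "h 1 = 1"
  shows "h (pell_u e k u w n) = pell_u (h e) (h k) (h u) (h w) n"
    and "h (pell_w e k u w n) = pell_w (h e) (h k) (h u) (h w) n"
proof -
  have zero: "h 0 = 0" using assms(1)[of 0 0] by simp
  have "h (- x) + h x = 0" for x using assms(1)[of "- x" x] zero by simp
  then have "h (- x) = - h x" for x by (simp add: eq_neg_iff_add_eq_0)
  then have diff: "h (x - y) = h x - h y" for x y using assms(1)[of x "- y"] by simp
  have "h (of_nat i) = of_nat i" for i
    by (induction i) (simp_all add: assms zero)
  then have num: "h (numeral i) = numeral i" for i
    by (metis of_nat_numeral)
  show "h (pell_u e k u w n) = pell_u (h e) (h k) (h u) (h w) n"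
    and "h (pell_w e k u w n) = pell_w (h e) (h k) (h u) (h w) n"
    by (induction n) (simp_all add: assms diff num power2_eq_square)
qed

text \<open>Numerator and denominator of the fibre parameter \<open>m\<close>.\<close>

definition ratio_num :: "pt \<Rightarrow> complex" where "ratio_num = (\<lambda>(a, b, c, d). a + d)"
definition ratio_den :: "pt \<Rightarrow> complex" where "ratio_den = (\<lambda>(a, b, c, d). c - b)"

text \<open>The initial values are \<open>3*u\<close> and \<open>3*w\<close>, which keeps the coefficients integral.\<close>

definition iter_u :: "nat \<Rightarrow> pt \<Rightarrow> complex" where
  "iter_u n = (\<lambda>(a, b, c, d). pell_u (a + d) (c - b) (3*(c - b)) (d - a) n)"

definition iter_w :: "nat \<Rightarrow> pt \<Rightarrow> complex" where
  "iter_w n = (\<lambda>(a, b, c, d). pell_w (a + d) (c - b) (3*(c - b)) (d - a) n)"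

lemma qpoly_coord_sum_diff:
  "(\<lambda>(a, b, c, d). a + d) \<in> qpoly" "(\<lambda>(a, b, c, d). c - b) \<in> qpoly"
  "(\<lambda>(a, b, c, d). d - a) \<in> qpoly"
  using qpoly.add[OF qpoly.var1 qpoly.var4] qpoly_diff[OF qpoly.var3 qpoly.var2]
    qpoly_diff[OF qpoly.var4 qpoly.var1]
  by (simp_all add: case_prod_unfold)

lemma qpoly_ratio: "ratio_num \<in> qpoly" "ratio_den \<in> qpoly"
  by (simp_all add: ratio_num_def ratio_den_def qpoly_coord_sum_diff)

lemma iter_rec:
  "iter_u 0 x = 3 * ratio_den x"
  "iter_u (Suc n) x = (ratio_num x^2 - 5*ratio_den x^2) * iter_u n x
     + (ratio_num x^2 - 9*ratio_den x^2) * iter_w n x"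
  "iter_w (Suc n) x = (ratio_num x^2 - ratio_den x^2) * iter_u n x
     + (ratio_num x^2 - 5*ratio_den x^2) * iter_w n x"
  by (simp_all add: iter_u_def iter_w_def ratio_num_def ratio_den_def case_prod_unfold)

lemma qpoly_iter: "iter_u n \<in> qpoly" "iter_w n \<in> qpoly"
proof (induction n)
  case 0
  show "iter_u 0 \<in> qpoly"
    using qpoly.mult[OF qpoly_numeral[of "num.Bit1 num.One"] qpoly_ratio(2)]
    by (simp add: iter_rec(1)[abs_def])
  show "iter_w 0 \<in> qpoly"
    using qpoly_coord_sum_diff(3) by (simp add: iter_w_def)
next
  case (Suc n)
  show "iter_u (Suc n) \<in> qpoly" "iter_w (Suc n) \<in> qpoly"
    unfolding iter_rec(2,3)[abs_def]
    by (intro qpoly_intros qpoly_ratio Suc)+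
qed

text \<open>Up to nonzero scaling, the factors are those in \<open>nz\<close> of
  \<open>zeta_conic_point\<close>. As \<open>m\<close> is invariant, \<open>m + 3\<close> occurs
  once; the step from \<open>i\<close> to \<open>i + 1\<close> needs \<open>u\<close> and
  \<open>u + w\<close> at \<open>i\<close>, hence \<open>i < n\<close>.\<close>

definition defined_locus :: "nat \<Rightarrow> pt \<Rightarrow> complex" where
  "defined_locus n x = ratio_den x * (ratio_num x + 3 * ratio_den x) *
     (\<Prod>i<n. iter_u i x * (iter_u i x + iter_w i x))"

lemma qpoly_defined_locus: "defined_locus n \<in> qpoly"
  unfolding defined_locus_def[abs_def]
  by (intro qpoly_intros qpoly_prod qpoly_ratio qpoly_iter)

text \<open>All coefficients of the recursion are positive here; \<open>j\<close> allows a late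
  start, after initial negative values.\<close>

lemma pell_pos:
  fixes e k :: real
  assumes "9*k^2 < e^2" "0 < pell_u e k u w j" "0 < pell_w e k u w j"
  shows "j \<le> i \<Longrightarrow> 0 < pell_u e k u w i \<and> 0 < pell_w e k u w i"
proof (induction i rule: dec_induct)
  case base
  then show ?case using assms by simp
next
  case (step i)
  have "0 < e^2 - 9*k^2" "0 < e^2 - 5*k^2" "0 < e^2 - k^2"
    using assms(1) zero_le_power2[of k] by linarith+
  then show ?case using step.IH by (simp add: add_pos_pos)
qed

text \<open>
  Both square roots of 17 must be treated. For the negative one \<open>u\<close> and \<open>w\<close> have opposite signs at
  first, and both are positive from the second iterate on.
\<close>

lemma pell_witness:
  fixes r :: real
  assumes r: "r^2 = 17"
  shows "pell_u (3*r) 3 9 (3*r) i \<noteq> 0 \<and> pell_u (3*r) 3 9 (3*r) i + pell_w (3*r) 3 9 (3*r) i \<noteq> 0"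
proof -
  let ?U = "pell_u (3*r) 3 9 (3*r)" and ?W = "pell_w (3*r) 3 9 (3*r)"
  have r': "(3*r)^2 = 153" using r by (simp add: power_mult_distrib)
  have big: "9*3^2 < (3*r)^2" using r' by simp
  have one: "?U (Suc 0) = 972 + 216*r" "?W (Suc 0) = 1296 + 324*r"
    unfolding pell_u.simps pell_w.simps r' by simp_all
  have two: "?U (Suc (Suc 0)) = 198288 + 46656*r" "?W (Suc (Suc 0)) = 279936 + 66096*r"
    unfolding pell_u.simps(2)[of _ _ _ _ "Suc 0"] pell_w.simps(2)[of _ _ _ _ "Suc 0"] one r'
    by simp_all
  show ?thesis
  proof (cases "r > 0")
    case True
    then show ?thesis
      using pell_pos[OF big, of 9 "3*r" 0 i] by auto
  next
    case False
    have "\<not> \<bar>r\<bar> \<ge> 42/10"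
      using abs_le_square_iff[of "42/10" r] r by (simp add: power2_eq_square)
    moreover have "\<not> \<bar>r\<bar> \<le> 4"
      using abs_le_square_iff[of r 4] r by simp
    moreover have "\<not> \<bar>r\<bar> \<ge> 4125/1000"
      using abs_le_square_iff[of "4125/1000" r] r by (simp add: power2_eq_square)
    \<comment> \<open>The root is about -4.123. The bounds suffice because \<open>?U + ?W\<close>
      vanishes at -3 for index 0 and at -4.2 for index 1, \<open>?U\<close> at -4.5 for index 1, and
      at index 2 \<open>?U\<close> and \<open>?W\<close> vanish at -4.25 and about -4.235.\<close>
    ultimately have b: "- 4125/1000 < r" "r < - 4" using False by linarith+
    then have "0 < ?U (Suc (Suc 0))" "0 < ?W (Suc (Suc 0))" unfolding two using b by linarith+
    from pell_pos[OF big this, of i] have "Suc (Suc 0) \<le> i \<Longrightarrow> ?thesis" by linarith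
    moreover have ?thesis if "i = 0" using that b by simp
    moreover have ?thesis if "i = Suc 0" unfolding that one using b by linarith
    ultimately show ?thesis by linarith
  qed
qed

text \<open>
  Over \<open>(b, c) = (7, 10)\<close> the surface has only the points with \<open>a = 0\<close>, \<open>d^2 = 153\<close>. There
  \<open>m^2 = 17 > 9\<close>, so the Pell recursion has positive coefficients.
\<close>

lemma defined_locus_fibre:
  assumes "(a, 7, 10, d) \<in> X4"
  shows "defined_locus n (a, 7, 10, d) \<noteq> 0"
proof -
  from assms have "a^2 = 0" "d^2 = 153" by (simp_all add: X4_def algebra_simps)
  then have a: "a = 0" and d: "d^2 = 153" by auto
  have "(3 * sqrt 17)^2 = 153" by (simp add: power_mult_distrib)
  then have "d^2 = of_real (3 * sqrt 17)^2"
    using d by (metis of_real_numeral of_real_power)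
  then have "d = of_real (3 * sqrt 17) \<or> d = - of_real (3 * sqrt 17)"
    by (simp only: power2_eq_iff)
  then have "d = of_real (3 * sqrt 17) \<or> d = of_real (3 * - sqrt 17)"
    by auto
  moreover have "(sqrt 17)^2 = 17" "(- sqrt 17)^2 = 17" by simp_all
  ultimately obtain r :: real where r: "r^2 = 17" "d = of_real (3*r)" by blast
  \<comment> \<open>The arguments are \<open>a + d = d\<close>, \<open>c - b = 3\<close>,
    \<open>3*(c - b) = 9\<close> and \<open>d - a = d\<close>.\<close>
  have "iter_u i (a, 7, 10, d) = of_real (pell_u (3*r) 3 9 (3*r) i)"
    "iter_w i (a, 7, 10, d) = of_real (pell_w (3*r) 3 9 (3*r) i)" for i
    using pell_hom[of "of_real :: real \<Rightarrow> complex" "3*r" 3 9 "3*r" i]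
    by (simp_all add: a r iter_u_def iter_w_def)
  then have "iter_u i (a, 7, 10, d) \<noteq> 0"
    "iter_u i (a, 7, 10, d) + iter_w i (a, 7, 10, d) \<noteq> 0" for i
    using pell_witness[OF r(1), of i]
    by (simp_all only: of_real_add[symmetric] of_real_eq_0_iff not_False_eq_True)
  moreover have "ratio_num (a, 7, 10, d) + 3 * ratio_den (a, 7, 10, d) \<noteq> 0"
  proof
    assume "ratio_num (a, 7, 10, d) + 3 * ratio_den (a, 7, 10, d) = 0"
    then have "d = - 9" by (simp add: ratio_num_def ratio_den_def a eq_neg_iff_add_eq_0)
    then show False using d by simp
  qed
  moreover have "ratio_den (a, 7, 10, d) \<noteq> 0" by (simp add: ratio_den_def)
  ultimately show ?thesis by (simp add: defined_locus_def)
qed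

section \<open>Degrees of the Pell recursion over \<open>rat poly\<close>\<close>

text \<open>Positivity of the leading coefficient excludes cancellation in sums of equal
  degree.\<close>

definition pos_degree :: "rat poly \<Rightarrow> nat \<Rightarrow> bool" where
  "pos_degree p n \<longleftrightarrow> degree p = n \<and> 0 < lead_coeff p"

lemma pos_degree_mult:
  assumes "pos_degree p m" "pos_degree q n"
  shows "pos_degree (p * q) (m + n)"
proof -
  have "p \<noteq> 0" "q \<noteq> 0" using assms by (auto simp: pos_degree_def)
  then show ?thesis
    using assms by (auto simp: pos_degree_def degree_mult_eq coeff_mult_degree_sum)
qed

lemma pos_degree_add:
  assumes "pos_degree p n" "pos_degree q n"
  shows "pos_degree (p + q) n"
proof -
  have "coeff (p + q) n > 0" using assms by (auto simp: pos_degree_def)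
  moreover have "degree (p + q) \<le> n"
    using assms degree_add_le[of p n q] by (auto simp: pos_degree_def)
  ultimately have "degree (p + q) = n"
    by (metis le_antisym le_degree less_irrefl)
  with \<open>coeff (p + q) n > 0\<close> show ?thesis by (simp add: pos_degree_def)
qed

lemma pos_degree_add_lower:
  assumes "pos_degree p n" "degree q < n"
  shows "pos_degree (p + q) n"
proof -
  have "degree q < degree p" using assms by (auto simp: pos_degree_def)
  then show ?thesis
    using assms by (auto simp: pos_degree_def degree_add_eq_left coeff_eq_0)
qed

text \<open>The three coefficients are quadratics in \<open>t\<close> with leading coefficient 4, so
  each step adds 2 to the degree.\<close>

lemma pos_degree_pell:
  defines "e \<equiv> [:3, 2:] :: rat poly"
  shows "pos_degree (pell_u e 1 3 3 n) (2*n) \<and> pos_degree (pell_w e 1 3 3 n) (2*n)"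
proof (induction n)
  case 0
  show ?case by (simp add: pos_degree_def numeral_poly)
next
  case (Suc n)
  have sq: "e^2 - 5*1^2 = [:4, 12, 4:]" "e^2 - 9*1^2 = [:0, 12, 4:]" "e^2 - 1^2 = [:8, 12, 4:]"
    by (simp_all add: e_def power2_eq_square numeral_poly one_pCons)
  have "pos_degree [:4, 12, 4:] 2" "pos_degree [:0, 12, 4:] 2" "pos_degree [:8, 12, 4:] 2"
    by (simp_all add: pos_degree_def)
  note step = this[THEN pos_degree_mult]
  have "2 * Suc n = 2 + 2*n" by simp
  then show ?case
    unfolding pell_u.simps pell_w.simps sq \<open>2 * Suc n = 2 + 2*n\<close>
    using Suc by (intro conjI pos_degree_add step) blast+
qed

section \<open>Iterates of \<open>zeta\<close> as rational maps\<close>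

text \<open>The multiplier has norm
  \<open>((m^2 - 5)^2 - (m^2 - 1)*(m^2 - 9))/16 = 1\<close>.\<close>

lemma conic_step:
  fixes m u w :: complex
  defines "u' \<equiv> ((m^2 - 5)*u + (m^2 - 9)*w)/4" and "w' \<equiv> ((m^2 - 1)*u + (m^2 - 5)*w)/4"
  shows "(m^2 - 1)*u'^2 - (m^2 - 9)*w'^2 = (m^2 - 1)*u^2 - (m^2 - 9)*w^2"
proof -
  have "4*u' = (m^2 - 5)*u + (m^2 - 9)*w" "4*w' = (m^2 - 1)*u + (m^2 - 5)*w"
    by (simp_all add: u'_def w'_def)
  then have "16*((m^2 - 1)*u'^2 - (m^2 - 9)*w'^2) = 16*((m^2 - 1)*u^2 - (m^2 - 9)*w^2)"
    by algebra
  then show ?thesis by (simp only: mult_cancel_left) simp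
qed

text \<open>\<open>D n\<close> undoes the scaling: 3 from the initial values, \<open>4*k^2\<close>
  from each step. The conic equation is carried along because the next application of
  \<open>zeta\<close> requires it.\<close>

lemma zeta_iter_conic_point:
  assumes x: "x \<in> X4"
  defines "m \<equiv> ratio_num x / ratio_den x" and "D \<equiv> \<lambda>n. 3 * (4 * ratio_den x^2)^n"
  assumes "defined_locus n x \<noteq> 0"
  shows "zeta_iter n x = Some (conic_point m (iter_u n x / D n) (iter_w n x / D n)) \<and>
    (m^2 - 1)*(iter_u n x / D n)^2 - (m^2 - 9)*(iter_w n x / D n)^2 = 8"
  using assms(4)
proof (induction n)
  case 0
  obtain a b c d where x_eq: "x = (a, b, c, d)" by (cases x)
  from 0 have "c \<noteq> b" by (simp add: defined_locus_def ratio_den_def x_eq)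
  note conic = conic_point_of_X4[OF x[unfolded x_eq] this]
  have vals: "m = (a + d)/(c - b)" "iter_u 0 x / D 0 = c - b" "iter_w 0 x / D 0 = (d - a)/3"
    by (simp_all add: x_eq m_def D_def iter_u_def iter_w_def ratio_num_def ratio_den_def)
  show ?case
    unfolding vals conic(1)[symmetric] using conic(2) x by (simp add: x_eq)
next
  case (Suc n)
  let ?k = "ratio_den x" and ?e = "ratio_num x"
  define u w where "u = iter_u n x / D n" and "w = iter_w n x / D n"
  have "defined_locus n x \<noteq> 0" and k: "?k \<noteq> 0" and e: "?e + 3 * ?k \<noteq> 0"
    and nz: "iter_u n x \<noteq> 0" "iter_u n x + iter_w n x \<noteq> 0"
    using Suc.prems by (auto simp: defined_locus_def)
  then have IH: "zeta_iter n x = Some (conic_point m u w)" "(m^2 - 1)*u^2 - (m^2 - 9)*w^2 = 8"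
    using Suc.IH by (simp_all add: u_def w_def)
  have D: "D n \<noteq> 0" using k by (simp add: D_def)
  have "u \<noteq> 0" using nz D by (simp add: u_def)
  moreover have "m + 3 \<noteq> 0" using e k by (simp add: m_def field_simps)
  moreover have "u + w \<noteq> 0" using nz D by (simp add: u_def w_def flip: add_divide_distrib)
  ultimately have "zeta (conic_point m u w) =
    Some (conic_point m (((m^2 - 5)*u + (m^2 - 9)*w)/4) (((m^2 - 1)*u + (m^2 - 5)*w)/4))"
    using zeta_conic_point IH(2) by blast
  moreover have "D (Suc n) = D n * (4 * ?k^2)" by (simp add: D_def)
  then have "((m^2 - 5)*u + (m^2 - 9)*w)/4 = iter_u (Suc n) x / D (Suc n)"
    "((m^2 - 1)*u + (m^2 - 5)*w)/4 = iter_w (Suc n) x / D (Suc n)"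
    using k D by (simp_all add: u_def w_def m_def iter_rec field_simps)
  ultimately show ?case
    using conic_step[of m u w] IH by (simp add: map_comp_def)
qed

lemma conic_point_divide:
  assumes "k \<noteq> 0" "D \<noteq> 0"
  shows "conic_point (e/k) (u/D) (w/D) = ((e*u - 3*(k*w)) / (2*(k*D)), (e*w - k*u) / (2*(k*D)),
    (k*u + e*w) / (2*(k*D)), (e*u + 3*(k*w)) / (2*(k*D)))"
  using assms by (simp add: conic_point_def field_simps)

text \<open>On the surface this representative is regular wherever \<open>c \<noteq> b\<close>, so
  on the whole line, even at \<open>t = -3\<close>, where \<open>m + 3 = 0\<close> and
  \<open>zeta\<close> yields \<open>None\<close>.\<close>

lemma zeta_iter_same_rational_map:
  "same_rational_map (zeta_iter n)
    (frac_map (\<lambda>x. ratio_num x * iter_u n x - 3 * (ratio_den x * iter_w n x))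
      (\<lambda>x. ratio_num x * iter_w n x - ratio_den x * iter_u n x)
      (\<lambda>x. ratio_den x * iter_u n x + ratio_num x * iter_w n x)
      (\<lambda>x. ratio_num x * iter_u n x + 3 * (ratio_den x * iter_w n x))
      (\<lambda>x. 2 * (ratio_den x * (3 * (4 * ratio_den x^2)^n))))"
  unfolding same_rational_map_def
proof (intro exI[of _ "{x \<in> X4. defined_locus n x \<noteq> 0}"] conjI ballI)
  show "dense_open {x \<in> X4. defined_locus n x \<noteq> 0}"
    by (rule dense_open_nonzero[OF qpoly_defined_locus defined_locus_fibre])
  fix x assume "x \<in> {x \<in> X4. defined_locus n x \<noteq> 0}"
  then have x: "x \<in> X4" "defined_locus n x \<noteq> 0" by auto
  then have k: "ratio_den x \<noteq> 0" by (auto simp: defined_locus_def)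
  note eq = zeta_iter_conic_point[OF x, THEN conjunct1]
  then show "zeta_iter n x \<noteq> None" by simp
  show "zeta_iter n x = frac_map (\<lambda>x. ratio_num x * iter_u n x - 3 * (ratio_den x * iter_w n x))
      (\<lambda>x. ratio_num x * iter_w n x - ratio_den x * iter_u n x)
      (\<lambda>x. ratio_den x * iter_u n x + ratio_num x * iter_w n x)
      (\<lambda>x. ratio_num x * iter_u n x + 3 * (ratio_den x * iter_w n x))
      (\<lambda>x. 2 * (ratio_den x * (3 * (4 * ratio_den x^2)^n))) x"
    unfolding eq using x(1) k by (subst conic_point_divide) (simp_all add: frac_map_def)
qed

section \<open>Specialization to the line\<close>

text \<open>Evaluation at \<open>t\<close> is a ring homomorphism, and both initial values are 3 on
  the line, so \<open>pell_hom\<close> applies.\<close>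

lemma iter_on_line:
  fixes t :: int
  defines "x \<equiv> (of_int t, of_int (t + 1), of_int (t + 2), of_int (t + 3))"
    and "h \<equiv> \<lambda>p. of_rat (poly p (of_int t))"
  shows "x \<in> X4" "ratio_den x = 1" "ratio_num x = h [:3, 2:]"
    "iter_u n x = h (pell_u [:3, 2:] 1 3 3 n)" "iter_w n x = h (pell_w [:3, 2:] 1 3 3 n)"
proof -
  show "x \<in> X4" by (simp add: x_def X4_def power2_eq_square algebra_simps)
  show den: "ratio_den x = 1" by (simp add: x_def ratio_den_def)
  show num: "ratio_num x = h [:3, 2:]"
    by (simp add: x_def h_def ratio_num_def of_rat_add of_rat_mult)
  have "h (p + q) = h p + h q" "h (p * q) = h p * h q" "h 1 = 1" "h 3 = 3" for p q
    by (simp_all add: h_def of_rat_add of_rat_mult)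
  note hom = pell_hom[of h, OF this(1-3)] this(3,4)
  have "ratio_num x = of_int t + of_int (t + 3)" by (simp add: x_def ratio_num_def)
  then show "iter_u n x = h (pell_u [:3, 2:] 1 3 3 n)" "iter_w n x = h (pell_w [:3, 2:] 1 3 3 n)"
    by (simp_all add: iter_u_def iter_w_def x_def hom flip: num)
qed

theorem theorem1p1:
  shows "\<exists>\<xi>1 \<xi>2 \<xi>3 \<xi>4 :: nat \<Rightarrow> rat poly. \<forall>n.
           degree (\<xi>1 n) = 2 * n + 1 \<and> degree (\<xi>2 n) = 2 * n + 1 \<and>
           degree (\<xi>3 n) = 2 * n + 1 \<and> degree (\<xi>4 n) = 2 * n + 1 \<and>
           (\<forall>t :: int.
              has_value_at (zeta_iter n)
                (of_int t, of_int (t + 1), of_int (t + 2), of_int (t + 3))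
                (of_rat (poly (\<xi>1 n) (of_int t)), of_rat (poly (\<xi>2 n) (of_int t)),
                 of_rat (poly (\<xi>3 n) (of_int t)), of_rat (poly (\<xi>4 n) (of_int t))))"
proof -
  define e :: "rat poly" where "e = [:3, 2:]"
  define U W where "U = pell_u e 1 3 3" and "W = pell_w e 1 3 3"
  \<comment> \<open>The factor is the inverse of the common denominator at
    \<open>ratio_den x = 1\<close>.\<close>
  define \<xi> :: "rat poly \<Rightarrow> nat \<Rightarrow> rat poly" where "\<xi> p n = smult (1 / (6 * 4^n)) p" for p n
  have deg: "degree (\<xi> p n) = degree p" for p n by (simp add: \<xi>_def)
  have UW: "pos_degree (U n) (2*n)" "pos_degree (W n) (2*n)" for n
    using pos_degree_pell[of n] by (simp_all add: U_def W_def e_def)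
  have "pos_degree e 1" by (simp add: e_def pos_degree_def)
  note eUW = UW[THEN pos_degree_mult[OF this]]
  \<comment> \<open>Terms without the factor \<open>e\<close> have degree at most
    \<open>2*n\<close>, so they cannot cancel the leading term of \<open>e * U n\<close> or
    \<open>e * W n\<close>.\<close>
  have lower: "degree (- 3 * p) < 1 + 2*n" "degree (3 * p) < 1 + 2*n" "degree (- p) < 1 + 2*n"
    "degree p < 1 + 2*n" if "pos_degree p (2*n)" for p n
    using that degree_mult_le[of "- 3" p] degree_mult_le[of 3 p] by (auto simp: pos_degree_def)
  have "pos_degree (e * U n - 3 * W n) (1 + 2*n)" "pos_degree (e * W n - U n) (1 + 2*n)"
    "pos_degree (U n + e * W n) (1 + 2*n)" "pos_degree (e * U n + 3 * W n) (1 + 2*n)" for n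
    using pos_degree_add_lower[OF eUW(1) lower(1)[OF UW(2)], of n]
      pos_degree_add_lower[OF eUW(2) lower(3)[OF UW(1)], of n]
      pos_degree_add_lower[OF eUW(2) lower(4)[OF UW(1)], of n]
      pos_degree_add_lower[OF eUW(1) lower(2)[OF UW(2)], of n]
    by (simp_all add: add.commute)
  then have degs: "degree (e * U n - 3 * W n) = 2*n + 1" "degree (e * W n - U n) = 2*n + 1"
    "degree (U n + e * W n) = 2*n + 1" "degree (e * U n + 3 * W n) = 2*n + 1" for n
    by (simp_all add: pos_degree_def)
  have val: "has_value_at (zeta_iter n) (of_int t, of_int (t + 1), of_int (t + 2), of_int (t + 3))
      (of_rat (poly (\<xi> (e * U n - 3 * W n) n) (of_int t)),
       of_rat (poly (\<xi> (e * W n - U n) n) (of_int t)),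
       of_rat (poly (\<xi> (U n + e * W n) n) (of_int t)),
       of_rat (poly (\<xi> (e * U n + 3 * W n) n) (of_int t)))" for n and t :: int
  proof -
    let ?p = "(of_int t, of_int (t + 1), of_int (t + 2), of_int (t + 3)) :: pt"
    have "frac_map (\<lambda>x. ratio_num x * iter_u n x - 3 * (ratio_den x * iter_w n x))
      (\<lambda>x. ratio_num x * iter_w n x - ratio_den x * iter_u n x)
      (\<lambda>x. ratio_den x * iter_u n x + ratio_num x * iter_w n x)
      (\<lambda>x. ratio_num x * iter_u n x + 3 * (ratio_den x * iter_w n x))
      (\<lambda>x. 2 * (ratio_den x * (3 * (4 * ratio_den x^2)^n))) ?p =
      Some (of_rat (poly (\<xi> (e * U n - 3 * W n) n) (of_int t)),
        of_rat (poly (\<xi> (e * W n - U n) n) (of_int t)),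
        of_rat (poly (\<xi> (U n + e * W n) n) (of_int t)),
        of_rat (poly (\<xi> (e * U n + 3 * W n) n) (of_int t)))"
      using iter_on_line(1)[of t]
      unfolding frac_map_def iter_on_line[where t = t] e_def[symmetric]
        U_def[symmetric] W_def[symmetric]
      by (simp add: \<xi>_def of_rat_add of_rat_diff of_rat_mult of_rat_divide of_rat_power)
    note conj = conjI[OF zeta_iter_same_rational_map this]
    show ?thesis
      unfolding has_value_at_def
      by (rule bexI, rule bexI, rule bexI, rule bexI, rule bexI, rule conj)
         (intro qpoly_intros qpoly_ratio qpoly_iter)+
  qed
  show ?thesis
    by (intro exI[of _ "\<lambda>n. \<xi> (e * U n - 3 * W n) n"] exI[of _ "\<lambda>n. \<xi> (e * W n - U n) n"]
        exI[of _ "\<lambda>n. \<xi> (U n + e * W n) n"] exI[of _ "\<lambda>n. \<xi> (e * U n + 3 * W n) n"]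
        allI conjI val) (simp_all add: deg degs)
qed

end
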